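(* Let $G$ and $H$ be graphs without isolated vertices. Then $$(G\times H)^{[\natural 2]}=(G^{[[2]]}\,\square\, H^{[[2]]} )\uplus (G^{[[2]]}\times H^{[\natural 2]} )\uplus (G^{[\natural 2]}\times H^{[[2]]})\,.$$ In particular, if $G$ and $H$ are triangle-free, then $$(G\times H)^{[\natural 2]}=G^{[\natural 2]}\boxtimes H^{[\natural 2]}\,.$$
   Context: For a graph $G$, $G^{[\natural 2]}$ is the graph on $V(G)$ in which two vertices are adjacent iff their distance in $G$ is exactly $2$. $G^{[[2]]}$ is the graph on $V(G)$ in which two vertices $x,y$ are adjacent iff they are connected in $G$ by a path of length $2$ (i.e. $x\neq y$ and they have a common neighbor). If two graphs have the same vertex set, $\uplus$ denotes the graph on that vertex set whose edge set is the union of the edge sets. All products have vertex set $V(G)\times V(H)$. Direct product $G\times H$: $(g_1,h_1)(g_2,h_2)$ is an edge iff $g_1g_2\in E(G)$ and $h_1h_2\in E(H)$. Cartesian product $G\,\square\,H$: edge iff either $g_1g_2\in E(G)$ and $h_1=h_2$, or $g_1=g_2$ and $h_1h_2\in E(H)$. Strong product $G\boxtimes H$: distinct vertices adjacent iff $g_1g_2\in E(G)$ and $h_1=h_2$, or $g_1=g_2$ and $h_1h_2\in E(H)$, or $g_1g_2\in E(G)$ and $h_1h_2\in E(H)$. Equalities are equalities of graphs on $V(G)\times V(H)$. *)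

theory Defs
  imports "Graph_Theory.Pair_Digraph" "Graph_Theory.Shortest_Path"
begin

text \<open>
  Graphs are simple undirected graphs, possibly infinite: an undirected edge is a pair of
  opposite arcs, and the graph has no loops.
\<close>

abbreviation simple_graph :: "'a pair_pre_digraph \<Rightarrow> bool" where
  "simple_graph G \<equiv> pair_bidirected_digraph G"

definition isolated_vertex :: "'a pair_pre_digraph \<Rightarrow> 'a \<Rightarrow> bool" where
  "isolated_vertex G v \<longleftrightarrow> v \<in> pverts G \<and> \<not> (\<exists>u. (v, u) \<in> parcs G)"

definition triangle_free :: "'a pair_pre_digraph \<Rightarrow> bool" where
  "triangle_free G \<longleftrightarrow>
     \<not> (\<exists>u v w. (u, v) \<in> parcs G \<and> (v, w) \<in> parcs G \<and> (w, u) \<in> parcs G)"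

text \<open>
  With unit weights, the cost of a walk is its length; the distance is \<open>\<infinity>\<close> if there is no walk.
\<close>

definition graph_dist :: "'a pair_pre_digraph \<Rightarrow> 'a \<Rightarrow> 'a \<Rightarrow> ereal" where
  "graph_dist G u v = wf_digraph.\<mu> (with_proj G) (\<lambda>_. 1) u v"

text \<open>The graph $G^{[\natural 2]}$.\<close>

definition exact_dist2 :: "'a pair_pre_digraph \<Rightarrow> 'a pair_pre_digraph" where
  "exact_dist2 G =
     \<lparr> pverts = pverts G,
       parcs = {(u, v). u \<in> pverts G \<and> v \<in> pverts G \<and> graph_dist G u v = 2} \<rparr>"

text \<open>The graph $G^{[[2]]}$; the vertices of a path are distinct, so its ends differ.\<close>

definition path2 :: "'a pair_pre_digraph \<Rightarrow> 'a pair_pre_digraph" where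
  "path2 G =
     \<lparr> pverts = pverts G,
       parcs = {(u, v). \<exists>p. pre_digraph.apath (with_proj G) u p v \<and> length p = 2} \<rparr>"

text \<open>The operation $\uplus$; it is only used for graphs with the same vertex set.\<close>

definition edge_union ::
    "'a pair_pre_digraph \<Rightarrow> 'a pair_pre_digraph \<Rightarrow> 'a pair_pre_digraph" where
  "edge_union G H = \<lparr> pverts = pverts G \<union> pverts H, parcs = parcs G \<union> parcs H \<rparr>"

definition direct_product ::
    "'a pair_pre_digraph \<Rightarrow> 'b pair_pre_digraph \<Rightarrow> ('a \<times> 'b) pair_pre_digraph" where
  "direct_product G H =
     \<lparr> pverts = pverts G \<times> pverts H,
       parcs = {((g1, h1), (g2, h2)). (g1, g2) \<in> parcs G \<and> (h1, h2) \<in> parcs H} \<rparr>"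

definition cartesian_product ::
    "'a pair_pre_digraph \<Rightarrow> 'b pair_pre_digraph \<Rightarrow> ('a \<times> 'b) pair_pre_digraph" where
  "cartesian_product G H =
     \<lparr> pverts = pverts G \<times> pverts H,
       parcs = {((g1, h1), (g2, h2)).
         (g1, h1) \<in> pverts G \<times> pverts H \<and> (g2, h2) \<in> pverts G \<times> pverts H \<and>
         ((g1, g2) \<in> parcs G \<and> h1 = h2 \<or> g1 = g2 \<and> (h1, h2) \<in> parcs H)} \<rparr>"

definition strong_product ::
    "'a pair_pre_digraph \<Rightarrow> 'b pair_pre_digraph \<Rightarrow> ('a \<times> 'b) pair_pre_digraph" where
  "strong_product G H =
     \<lparr> pverts = pverts G \<times> pverts H,
       parcs = {((g1, h1), (g2, h2)).
         (g1, h1) \<in> pverts G \<times> pverts H \<and> (g2, h2) \<in> pverts G \<times> pverts H \<and>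
         (g1, h1) \<noteq> (g2, h2) \<and>
         ((g1, g2) \<in> parcs G \<and> h1 = h2 \<or>
          g1 = g2 \<and> (h1, h2) \<in> parcs H \<or>
          (g1, g2) \<in> parcs G \<and> (h1, h2) \<in> parcs H)} \<rparr>"

end

theory Submission
  imports Defs
begin

text \<open>
  In an undirected graph the vertices with a common neighbour are those related by
  \<open>parcs G O parcs G\<close>, so \<open>G\<^bsup>[[2]]\<^esup>\<close> is this relation off the diagonal, and
  \<open>G\<^bsup>[\<natural>2]\<^esup>\<close> is what remains after the edges of \<open>G\<close> are removed as well.
  In \<open>G \<times> H\<close> a common neighbour is a pair of common neighbours of the coordinates, and a vertex
  shares a neighbour with itself because it is not isolated. Hence distinct vertices with a common
  neighbour either agree in one coordinate (and are then non-adjacent, as there are no loops) or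
  are joined by a path of length 2 in both coordinates, in which case non-adjacency in \<open>G \<times> H\<close>
  means non-adjacency in at least one coordinate. In a triangle-free graph
  \<open>G\<^bsup>[[2]]\<^esup> = G\<^bsup>[\<natural>2]\<^esup>\<close>.
\<close>

lemma pair_pre_digraph_eqI:
  fixes G H :: "'a pair_pre_digraph"
  assumes "pverts G = pverts H" and "parcs G = parcs H"
  shows "G = H"
  using assms by (simp add: pair_pre_digraph.equality)

lemma pverts_exact_dist2 [simp]: "pverts (exact_dist2 G) = pverts G"
  by (simp add: exact_dist2_def)

lemma pverts_path2 [simp]: "pverts (path2 G) = pverts G"
  by (simp add: path2_def)

lemma pverts_edge_union [simp]: "pverts (edge_union G H) = pverts G \<union> pverts H"
  by (simp add: edge_union_def)

lemma parcs_edge_union [simp]: "parcs (edge_union G H) = parcs G \<union> parcs H"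
  by (simp add: edge_union_def)

lemma edge_union_absorb: "edge_union (edge_union G H) H = edge_union G H"
  by (simp add: edge_union_def Un_assoc)

lemma pverts_direct_product [simp]: "pverts (direct_product G H) = pverts G \<times> pverts H"
  by (simp add: direct_product_def)

lemma mem_parcs_direct_product [simp]:
  "((g, h), (g', h')) \<in> parcs (direct_product G H) \<longleftrightarrow> (g, g') \<in> parcs G \<and> (h, h') \<in> parcs H"
  by (simp add: direct_product_def)

lemma mem_relcomp_parcs_direct_product:
  "((g, h), (g', h')) \<in> parcs (direct_product G H) O parcs (direct_product G H) \<longleftrightarrow>
     (g, g') \<in> parcs G O parcs G \<and> (h, h') \<in> parcs H O parcs H"
  by (auto simp: relcomp_unfold)

lemma pair_wf_digraph_direct_product:
  assumes "pair_wf_digraph G" and "pair_wf_digraph H"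
  shows "pair_wf_digraph (direct_product G H)"
  using assms by (fastforce simp: pair_wf_digraph_def)

lemma pverts_cartesian_product [simp]: "pverts (cartesian_product G H) = pverts G \<times> pverts H"
  by (simp add: cartesian_product_def)

lemma mem_parcs_cartesian_product:
  assumes "pair_wf_digraph G" and "pair_wf_digraph H"
  shows "((g, h), (g', h')) \<in> parcs (cartesian_product G H) \<longleftrightarrow>
    (g, g') \<in> parcs G \<and> h = h' \<and> h \<in> pverts H \<or> g = g' \<and> g \<in> pverts G \<and> (h, h') \<in> parcs H"
proof -
  interpret G: pair_wf_digraph G by fact
  interpret H: pair_wf_digraph H by fact
  show ?thesis
    by (auto simp: cartesian_product_def dest: G.wellformed' H.wellformed')
qed

lemma strong_product_eq_edge_union:
  assumes "pair_loopfree_digraph G" and "pair_loopfree_digraph H"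
  shows "strong_product G H = edge_union (cartesian_product G H) (direct_product G H)"
proof -
  interpret G: pair_loopfree_digraph G by fact
  interpret H: pair_loopfree_digraph H by fact
  show ?thesis
    by (auto simp: strong_product_def edge_union_def cartesian_product_def direct_product_def
        dest: G.wellformed' H.wellformed' G.no_loops' H.no_loops')
qed

context pair_wf_digraph
begin

lemma graph_dist_eq_INF_length: "graph_dist G u v = (INF p\<in>{p. awalk u p v}. ereal (length p))"
proof -
  have "awalk_cost (\<lambda>_. 1) p = length p" for p
    by (induction p) auto
  then show ?thesis by (simp add: graph_dist_def \<mu>_def)
qed

lemma graph_dist_less_iff: "graph_dist G u v < ereal n \<longleftrightarrow> (\<exists>p. awalk u p v \<and> length p < n)"
  by (simp add: graph_dist_eq_INF_length INF_less_iff)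

lemma graph_dist_eq_iff:
  "graph_dist G u v = ereal n \<longleftrightarrow>
    (\<exists>p. awalk u p v \<and> length p = n) \<and> \<not> (\<exists>p. awalk u p v \<and> length p < n)"
proof
  assume dist: "graph_dist G u v = ereal n"
  then have no_shorter: "\<not> (\<exists>p. awalk u p v \<and> length p < n)"
    using graph_dist_less_iff[of u v n] by simp
  have "graph_dist G u v < ereal (Suc n)"
    by (simp add: dist)
  then have "\<exists>p. awalk u p v \<and> length p < Suc n"
    by (simp only: graph_dist_less_iff)
  with no_shorter show "(\<exists>p. awalk u p v \<and> length p = n) \<and> \<not> (\<exists>p. awalk u p v \<and> length p < n)"
    by (auto simp: less_Suc_eq)
next
  assume walks: "(\<exists>p. awalk u p v \<and> length p = n) \<and> \<not> (\<exists>p. awalk u p v \<and> length p < n)"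
  then have "graph_dist G u v \<le> ereal n"
    unfolding graph_dist_eq_INF_length by (auto intro: INF_lower)
  moreover have "\<not> graph_dist G u v < ereal n"
    using walks by (simp add: graph_dist_less_iff)
  ultimately show "graph_dist G u v = ereal n" by simp
qed

lemma ex_awalk_length_iff_relpow:
  "(\<exists>p. awalk u p v \<and> length p = n) \<longleftrightarrow> u \<in> pverts G \<and> (u, v) \<in> parcs G ^^ n"
proof (induction n arbitrary: u)
  case 0
  show ?case by (auto simp: awalk_Nil_iff)
next
  case (Suc n)
  have "(\<exists>p. awalk u p v \<and> length p = Suc n) \<longleftrightarrow>
      (\<exists>e q. awalk u (e # q) v \<and> length q = n)"
    unfolding length_Suc_conv by blast
  also have "\<dots> \<longleftrightarrow> (\<exists>w. (u, w) \<in> parcs G \<and> (\<exists>p. awalk w p v \<and> length p = n))"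
    by (auto simp: awalk_Cons_iff)
  also have "\<dots> \<longleftrightarrow> u \<in> pverts G \<and> (u, v) \<in> parcs G ^^ Suc n"
    unfolding Suc.IH relpow.simps(2) relpow_commute[symmetric] by (blast dest: wellformed')
  finally show ?case .
qed

lemma graph_dist_eq_iff_relpow:
  "graph_dist G u v = ereal n \<longleftrightarrow>
    u \<in> pverts G \<and> (u, v) \<in> parcs G ^^ n \<and> (\<forall>m<n. (u, v) \<notin> parcs G ^^ m)"
proof -
  have "(\<exists>p. awalk u p v \<and> length p < n) \<longleftrightarrow> (\<exists>m<n. \<exists>p. awalk u p v \<and> length p = m)"
    by auto
  then show ?thesis
    unfolding graph_dist_eq_iff ex_awalk_length_iff_relpow by blast
qed

lemma parcs_exact_dist2: "parcs (exact_dist2 G) = parcs G O parcs G - parcs G - Id"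
proof -
  have "graph_dist G u v = 2 \<longleftrightarrow> (u, v) \<in> parcs G O parcs G - parcs G - Id" for u v
    using graph_dist_eq_iff_relpow[of u v 2]
    by (auto simp: numeral_2_eq_2 less_Suc_eq dest: wellformed')
  then show ?thesis
    by (auto simp: exact_dist2_def dest: wellformed')
qed

lemma pair_loopfree_digraph_exact_dist2: "pair_loopfree_digraph (exact_dist2 G)"
  by unfold_locales (auto simp: parcs_exact_dist2 dest: wellformed')

end

context pair_loopfree_digraph
begin

lemma parcs_path2: "parcs (path2 G) = parcs G O parcs G - Id"
proof (intro equalityI subrelI)
  fix u v
  assume "(u, v) \<in> parcs (path2 G)"
  then obtain p where p: "apath u p v" "length p = 2"
    by (auto simp: path2_def)
  then have "u \<noteq> v"
    using apath_nonempty_ends by fastforce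
  moreover have "(u, v) \<in> parcs G ^^ 2"
    using p ex_awalk_length_iff_relpow awalkI_apath by blast
  ultimately show "(u, v) \<in> parcs G O parcs G - Id"
    by (simp add: numeral_2_eq_2)
next
  fix u v
  assume "(u, v) \<in> parcs G O parcs G - Id"
  then obtain w where "u \<noteq> v" "(u, w) \<in> parcs G" "(w, v) \<in> parcs G"
    by blast
  then have "apath u [(u, w), (w, v)] v"
    by (auto simp: apath_simps dest: wellformed' no_loops')
  then show "(u, v) \<in> parcs (path2 G)"
    by (fastforce simp: path2_def)
qed

lemma pair_wf_digraph_path2: "pair_wf_digraph (path2 G)"
  by unfold_locales (auto simp: parcs_path2 dest: wellformed')

end

lemma (in pair_sym_digraph) triangle_free_iff:
  "triangle_free G \<longleftrightarrow> parcs G O parcs G \<inter> parcs G = {}"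
  unfolding triangle_free_def by (blast dest: arcs_symmetric)

lemma (in pair_bidirected_digraph) path2_eq_exact_dist2:
  assumes "triangle_free G"
  shows "path2 G = exact_dist2 G"
  using assms unfolding triangle_free_iff
  by (intro pair_pre_digraph_eqI) (auto simp: parcs_path2 parcs_exact_dist2)

lemma (in pair_sym_digraph) Id_on_pverts_subset_relcomp_parcs:
  assumes "\<not> (\<exists>v. isolated_vertex G v)"
  shows "Id_on (pverts G) \<subseteq> parcs G O parcs G"
proof
  fix e
  assume "e \<in> Id_on (pverts G)"
  then obtain v where e: "e = (v, v)" and "v \<in> pverts G"
    by blast
  then obtain w where "(v, w) \<in> parcs G"
    using assms by (auto simp: isolated_vertex_def)
  then show "e \<in> parcs G O parcs G"
    unfolding e by (blast intro: arcs_symmetric)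
qed

lemma exact_dist2_direct_product:
  assumes "pair_loopfree_digraph G" and "pair_loopfree_digraph H"
    and G_diag: "Id_on (pverts G) \<subseteq> parcs G O parcs G"
    and H_diag: "Id_on (pverts H) \<subseteq> parcs H O parcs H"
  shows "exact_dist2 (direct_product G H) =
           edge_union
             (edge_union
               (cartesian_product (path2 G) (path2 H))
               (direct_product (path2 G) (exact_dist2 H)))
             (direct_product (exact_dist2 G) (path2 H))" (is "?L = ?R")
proof (rule pair_pre_digraph_eqI)
  interpret G: pair_loopfree_digraph G by fact
  interpret H: pair_loopfree_digraph H by fact
  interpret GH: pair_wf_digraph "direct_product G H"
    by (intro pair_wf_digraph_direct_product G.pair_wf_digraph_axioms H.pair_wf_digraph_axioms)
  note parcs = G.parcs_path2 H.parcs_path2 G.parcs_exact_dist2 H.parcs_exact_dist2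
    mem_parcs_cartesian_product[OF G.pair_wf_digraph_path2 H.pair_wf_digraph_path2]
  show "pverts ?L = pverts ?R" by simp
  have "((g, h), (g', h')) \<in> parcs ?L \<longleftrightarrow> ((g, h), (g', h')) \<in> parcs ?R" for g h g' h'
  proof -
    have L: "((g, h), (g', h')) \<in> parcs ?L \<longleftrightarrow>
        (g, g') \<in> parcs G O parcs G \<and> (h, h') \<in> parcs H O parcs H \<and>
        \<not> ((g, g') \<in> parcs G \<and> (h, h') \<in> parcs H) \<and> (g, h) \<noteq> (g', h')"
      by (simp add: GH.parcs_exact_dist2 mem_relcomp_parcs_direct_product)
    consider (same_fst) "g = g'" | (same_snd) "h = h'" | (distinct) "g \<noteq> g'" "h \<noteq> h'"
      by blast
    then show ?thesis
    proof cases
      case same_fst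
      have "(g, g) \<in> parcs G O parcs G \<longleftrightarrow> g \<in> pverts G"
        using G_diag by (blast dest: G.wellformed')
      with same_fst show ?thesis
        unfolding L by (auto simp: parcs dest: G.no_loops')
    next
      case same_snd
      have "(h, h) \<in> parcs H O parcs H \<longleftrightarrow> h \<in> pverts H"
        using H_diag by (blast dest: H.wellformed')
      with same_snd show ?thesis
        unfolding L by (auto simp: parcs dest: H.no_loops')
    next
      case distinct
      then show ?thesis
        unfolding L by (auto simp: parcs)
    qed
  qed
  then show "parcs ?L = parcs ?R" by auto
qed

theorem theorem2p4:
  fixes G :: "'a pair_pre_digraph" and H :: "'b pair_pre_digraph"
  assumes "simple_graph G" and "simple_graph H"
    and "\<not> (\<exists>v. isolated_vertex G v)" and "\<not> (\<exists>v. isolated_vertex H v)"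
  shows "exact_dist2 (direct_product G H) =
           edge_union
             (edge_union
               (cartesian_product (path2 G) (path2 H))
               (direct_product (path2 G) (exact_dist2 H)))
             (direct_product (exact_dist2 G) (path2 H))
         \<and> (triangle_free G \<and> triangle_free H \<longrightarrow>
              exact_dist2 (direct_product G H) =
                strong_product (exact_dist2 G) (exact_dist2 H))"
    (is "?dist2 = ?union \<and> (_ \<longrightarrow> _ = ?strong)")
proof (intro conjI impI)
  interpret G: pair_bidirected_digraph G by fact
  interpret H: pair_bidirected_digraph H by fact
  show union: "?dist2 = ?union"
    by (intro exact_dist2_direct_product G.pair_loopfree_digraph_axioms
        H.pair_loopfree_digraph_axioms G.Id_on_pverts_subset_relcomp_parcs
        H.Id_on_pverts_subset_relcomp_parcs assms)
  assume "triangle_free G \<and> triangle_free H"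
  then have "?union = edge_union (cartesian_product (exact_dist2 G) (exact_dist2 H))
      (direct_product (exact_dist2 G) (exact_dist2 H))"
    by (simp add: G.path2_eq_exact_dist2 H.path2_eq_exact_dist2 edge_union_absorb)
  also have "\<dots> = ?strong"
    by (intro strong_product_eq_edge_union[symmetric] G.pair_loopfree_digraph_exact_dist2
        H.pair_loopfree_digraph_exact_dist2)
  finally show "?dist2 = ?strong"
    unfolding union .
qed

end
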